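(* Let $(X,T)$ be a minimal topological dynamical system with a $T$-invariant Borel probability measure $\mu$, let $r\in\mathbb{N}$ with $r\geq 2$, and let $\pi_{eq}:(X,T)\rightarrow (X_{eq},S)$ be the maximal equicontinuous factor of $(X,T)$. Then the following statements are equivalent: 1) $(X,T)$ is multi-$r$-sensitive for $\mu$. 2) $(X,T)$ is thickly $r$-sensitive for $\mu$. 3) $(X,T)$ is thickly syndetically $r$-sensitive for $\mu$. 4) For every $m\in\{1,2,\cdots,r-1\}$, $\pi_{eq}$ is not an almost $m$ to one extension.
   Context: $\mathbb{N}=\{1,2,3,\dots\}$ denotes the natural numbers and $\mathbb{Z}_+$ the nonnegative integers. A topological dynamical system (TDS) is a pair $(X,T)$ where $X$ is a compact metric space with metric $d$ and $T:X\to X$ is a homeomorphism. $(X,T)$ is minimal if $\{T^nx:n\in\mathbb{Z}\}$ is dense in $X$ for every $x\in X$. $(X,T)$ is equicontinuous if $\{T^n:n\geq 0\}$ is equicontinuous at every point of $X$. $\mathcal{B}_X$ is the Borel $\sigma$-algebra of $X$ and $\mathcal{B}_{X,\mu}^+=\{B\in\mathcal{B}_X:\mu(B)>0\}$. The regionally proximal relation $Q(X,T)\subset X\times X$ consists of all $(x,y)$ such that for every $\epsilon>0$ there exist $x',y'\in X$ and $m\in\mathbb{Z}_+$ with $d(x,x')<\epsilon$, $d(y,y')<\epsilon$ and $d(T^mx',T^my')<\epsilon$. For minimal $(X,T)$, $Q(X,T)$ is a closed invariant equivalence relation, and the quotient $X_{eq}=X/Q(X,T)$ with the induced homeomorphism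 $S$ is the maximal equicontinuous factor of $(X,T)$; $\pi_{eq}:X\to X_{eq}$ is the corresponding factor map (continuous surjection with $\pi_{eq}\circ T=S\circ\pi_{eq}$). $\pi_{eq}$ is an almost $m$ to one extension if there exists a dense $G_\delta$ subset $A$ of $X_{eq}$ such that $\#\pi_{eq}^{-1}(y)=m$ for every $y\in A$. A set $A\subset\mathbb{N}$ is: thick if for every $k\in\mathbb{N}$ there is $n\in\mathbb{N}$ with $\{n,n+1,\dots,n+k\}\subset A$; syndetic if there is $k\in\mathbb{N}$ such that $\{n,n+1,\dots,n+k\}\cap A\neq\emptyset$ for every $n\in\mathbb{N}$; thickly syndetic if for each $k\in\mathbb{N}$ the set $\{n\in\mathbb{Z}_+:\{n,n+1,\dots,n+k\}\subset A\}$ is syndetic. For $\delta>0$ and a non-empty $U\subset X$ put $$N_T(U,\delta;r)=\{n\in\mathbb{N}:\exists\, x_1,\dots,x_r\in U\text{ such that }\min_{1\leq i\neq j\leq r}d(T^nx_i,T^nx_j)>\delta\}.$$ $(X,T)$ is thickly $r$-sensitive for $\mu$ (resp. thickly syndetically $r$-sensitive for $\mu$) if there exists $\delta>0$ such that $N_T(U,\delta;r)$ is thick (resp. thickly syndetic) for every $U\in\mathcal{B}_{X,\mu}^+$. $(X,T)$ is multi-$r$-sensitive for $\mu$ if there exists $\delta>0$ such that $\bigcap_{i=1}^kN_T(U_i,\delta;r)\neq\emptyset$ for every $k\in\mathbb{N}$ and every $U_1,\dots,U_k\in\mathcal{B}_{X,\mu}^+$. *)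

theory Defs
  imports "HOL-Probability.Probability"
begin

text \<open>The phase space is the whole of a type of class \<^class>\<open>metric_space\<close>, assumed compact.\<close>

definition tds :: "('a::metric_space \<Rightarrow> 'a) \<Rightarrow> bool" where
  "tds T \<longleftrightarrow> compact (UNIV :: 'a set) \<and> homeomorphism UNIV UNIV T (inv T)"

text \<open>The two-sided orbit, split into its forward and its backward half.\<close>

definition two_sided_orbit :: "('a \<Rightarrow> 'a) \<Rightarrow> 'a \<Rightarrow> 'a set" where
  "two_sided_orbit T x = range (\<lambda>n::nat. (T ^^ n) x) \<union> range (\<lambda>n::nat. (inv T ^^ n) x)"

definition minimal_tds :: "('a::metric_space \<Rightarrow> 'a) \<Rightarrow> bool" where
  "minimal_tds T \<longleftrightarrow> tds T \<and> (\<forall>x. closure (two_sided_orbit T x) = UNIV)"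

definition invariant_prob :: "('a::metric_space \<Rightarrow> 'a) \<Rightarrow> 'a measure \<Rightarrow> bool" where
  "invariant_prob T \<mu> \<longleftrightarrow> sets \<mu> = sets borel \<and> prob_space \<mu> \<and>
     (\<forall>B\<in>sets borel. emeasure \<mu> (T -` B) = emeasure \<mu> B)"

definition regionally_proximal :: "('a::metric_space \<Rightarrow> 'a) \<Rightarrow> ('a \<times> 'a) set" where
  "regionally_proximal T = {(x, y). \<forall>\<epsilon>>0. \<exists>x' y'. \<exists>m::nat.
     dist x x' < \<epsilon> \<and> dist y y' < \<epsilon> \<and> dist ((T ^^ m) x') ((T ^^ m) y') < \<epsilon>}"

text \<open>
  The maximal equicontinuous factor of a minimal system: its points are the classes of the
  regionally proximal relation, with the quotient topology. The induced homeomorphism is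
  the map on classes induced by \<open>T\<close>; nothing below depends on it.
\<close>

definition pi_eq :: "('a::metric_space \<Rightarrow> 'a) \<Rightarrow> 'a \<Rightarrow> 'a set" where
  "pi_eq T x = regionally_proximal T `` {x}"

definition X_eq :: "('a::metric_space \<Rightarrow> 'a) \<Rightarrow> 'a set topology" where
  "X_eq T = topology (\<lambda>V. V \<subseteq> UNIV // regionally_proximal T \<and> open (pi_eq T -` V))"

lemma openin_X_eq:
  "openin (X_eq T) V \<longleftrightarrow> V \<subseteq> UNIV // regionally_proximal T \<and> open (pi_eq T -` V)"
proof -
  have "istopology (\<lambda>V. V \<subseteq> UNIV // regionally_proximal T \<and> open (pi_eq T -` V))"
    unfolding istopology_def by (auto simp: vimage_Union intro: open_Int)
  then show ?thesis by (simp add: X_eq_def)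
qed

lemma range_pi_eq: "range (pi_eq T) = UNIV // regionally_proximal T"
  by (auto simp: pi_eq_def quotient_def)

lemma topspace_X_eq: "topspace (X_eq T) = UNIV // regionally_proximal T"
proof -
  have "pi_eq T -` (UNIV // regionally_proximal T) = UNIV"
    using range_pi_eq[of T] by blast
  then have "openin (X_eq T) (UNIV // regionally_proximal T)"
    by (simp add: openin_X_eq)
  then show ?thesis
    unfolding topspace_def by (auto simp: openin_X_eq)
qed

lemma quotient_map_pi_eq: "quotient_map euclidean (X_eq T) (pi_eq T)"
  unfolding quotient_map_def topspace_X_eq
  by (simp add: range_pi_eq openin_X_eq vimage_def)

definition almost_to_one :: "nat \<Rightarrow> 'b topology \<Rightarrow> ('a \<Rightarrow> 'b) \<Rightarrow> bool" where
  "almost_to_one m Y f \<longleftrightarrow>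
     (\<exists>A. gdelta_in Y A \<and> Y closure_of A = topspace Y \<and>
          (\<forall>y\<in>A. finite (f -` {y}) \<and> card (f -` {y}) = m))"

text \<open>
  Here the natural numbers start at 1, whence the explicit bounds; subsets of them are
  rendered as elements of \<^typ>\<open>nat set\<close>.
\<close>

definition thick :: "nat set \<Rightarrow> bool" where
  "thick A \<longleftrightarrow> (\<forall>k\<ge>1. \<exists>n\<ge>1. {n..n + k} \<subseteq> A)"

definition syndetic :: "nat set \<Rightarrow> bool" where
  "syndetic A \<longleftrightarrow> (\<exists>k\<ge>1. \<forall>n\<ge>1. {n..n + k} \<inter> A \<noteq> {})"

definition thickly_syndetic :: "nat set \<Rightarrow> bool" where
  "thickly_syndetic A \<longleftrightarrow> (\<forall>k\<ge>1. syndetic {n. {n..n + k} \<subseteq> A})"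

text \<open>The minimum over pairs exceeding \<open>\<delta>\<close> is written out as a condition on every pair.\<close>

definition N_T :: "('a::metric_space \<Rightarrow> 'a) \<Rightarrow> 'a set \<Rightarrow> real \<Rightarrow> nat \<Rightarrow> nat set" where
  "N_T T U \<delta> r = {n. n \<ge> 1 \<and> (\<exists>x :: nat \<Rightarrow> 'a. (\<forall>i\<in>{1..r}. x i \<in> U) \<and>
     (\<forall>i\<in>{1..r}. \<forall>j\<in>{1..r}. i \<noteq> j \<longrightarrow> dist ((T ^^ n) (x i)) ((T ^^ n) (x j)) > \<delta>))}"

definition borel_pos :: "'a::metric_space measure \<Rightarrow> 'a set set" where
  "borel_pos \<mu> = {B \<in> sets borel. emeasure \<mu> B > 0}"

definition thickly_sensitive :: "('a::metric_space \<Rightarrow> 'a) \<Rightarrow> 'a measure \<Rightarrow> nat \<Rightarrow> bool" where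
  "thickly_sensitive T \<mu> r \<longleftrightarrow> (\<exists>\<delta>>0. \<forall>U\<in>borel_pos \<mu>. thick (N_T T U \<delta> r))"

definition thickly_syndetically_sensitive ::
    "('a::metric_space \<Rightarrow> 'a) \<Rightarrow> 'a measure \<Rightarrow> nat \<Rightarrow> bool" where
  "thickly_syndetically_sensitive T \<mu> r \<longleftrightarrow>
     (\<exists>\<delta>>0. \<forall>U\<in>borel_pos \<mu>. thickly_syndetic (N_T T U \<delta> r))"

definition multi_sensitive :: "('a::metric_space \<Rightarrow> 'a) \<Rightarrow> 'a measure \<Rightarrow> nat \<Rightarrow> bool" where
  "multi_sensitive T \<mu> r \<longleftrightarrow>
     (\<exists>\<delta>>0. \<forall>k\<ge>1. \<forall>U :: nat \<Rightarrow> 'a set. (\<forall>i\<in>{1..k}. U i \<in> borel_pos \<mu>) \<longrightarrow>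
        (\<Inter>i\<in>{1..k}. N_T T (U i) \<delta> r) \<noteq> {})"

end

theory Submission
  imports Defs
begin

text \<open>
  For an open set \<open>U\<close> and a Borel set \<open>A\<close> let \<open>visits U A x\<close> be the union of the sets
  \<open>T\<^sup>-\<^sup>n A\<close> over all times \<open>n\<close> at which \<open>x\<close> visits \<open>U\<close>. Its measure is lower semicontinuous
  in \<open>x\<close> and monotone along orbits, hence constant by minimality, so the measure of
  \<open>visits U A x - visits U A y\<close> is a continuous \<open>T\<close>-invariant pseudometric (an idea of McMahon).
  Such pseudometrics vanish exactly on the regionally proximal relation, which makes it a closed
  invariant equivalence relation with equicontinuous quotient.

  If \<open>q\<^sub>1, \<dots>, q\<^sub>l\<close> lie in the fibre of \<open>x\<close>, \<open>U\<^sub>i\<close> is a neighbourhood of \<open>q\<^sub>i\<close>, and \<open>\<mu>(A) > 0\<close>,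
  then applying this repeatedly yields \<open>B \<subseteq> A\<close> of positive measure and times \<open>n\<^sub>i\<close> with
  \<open>T\<^bsup>n\<^sub>i\<^esup> x \<in> U\<^sub>i\<close> and \<open>T\<^bsup>n\<^sub>i\<^esup> B \<subseteq> A\<close>. Whenever \<open>T\<^sup>s b\<close>, for a fixed \<open>b \<in> B\<close>, is close to \<open>x\<close>,
  which happens syndetically often, the set \<open>T\<^sup>s A\<close> meets every \<open>U\<^sub>i\<close>. So fibres with at least
  \<open>r\<close> points, uniformly separated by a Baire argument, give thickly syndetic \<open>r\<close>-sensitivity. A fibre
  with fewer than \<open>r\<close> points excludes thick sensitivity, as equicontinuity of the factor brings
  a neighbourhood of that fibre back to itself syndetically often. Finally, the least cardinality of
  a fibre is attained on a dense \<open>G\<^sub>\<delta>\<close> set.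
\<close>

section \<open>Compactness of function spaces and separation in finite sets\<close>

lemma compact_UNIV_fun:
  assumes "compact (UNIV :: 'a::topological_space set)"
  shows "compact (UNIV :: ('b \<Rightarrow> 'a) set)"
proof -
  have "compact_space (product_topology (\<lambda>_::'b. euclidean :: 'a topology) UNIV)"
    using assms by (simp add: compact_space_product_topology compact_space_def[of euclidean])
  then show ?thesis
    by (simp add: compact_space_def euclidean_product_topology)
qed

lemma separated_points_iff_card:
  fixes C :: "'a::metric_space set"
  shows "(\<exists>k. \<exists>p :: nat \<Rightarrow> 'a. \<forall>i\<in>{1..n}. p i \<in> C \<and>
           (\<forall>j\<in>{1..n}. i \<noteq> j \<longrightarrow> 1 / real (Suc k) \<le> dist (p i) (p j)))
         \<longleftrightarrow> infinite C \<or> n \<le> card C" (is "?L \<longleftrightarrow> ?R")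
proof
  assume ?L
  then obtain k :: nat and p :: "nat \<Rightarrow> 'a" where
    p: "\<forall>i\<in>{1..n}. p i \<in> C \<and> (\<forall>j\<in>{1..n}. i \<noteq> j \<longrightarrow> 1 / real (Suc k) \<le> dist (p i) (p j))"
    by blast
  have "p i \<noteq> p j" if "i \<in> {1..n}" "j \<in> {1..n}" "i \<noteq> j" for i j
  proof
    assume "p i = p j"
    moreover have "1 / real (Suc k) \<le> dist (p i) (p j)" using p that by blast
    moreover have "1 / real (Suc k) > 0" by simp
    ultimately show False by simp
  qed
  then have "inj_on p {1..n}" unfolding inj_on_def by blast
  moreover have "p ` {1..n} \<subseteq> C" using p by blast
  ultimately show ?R
    using card_inj_on_le[of p "{1..n}" C] by auto
next
  assume ?R
  have "\<exists>S. S \<subseteq> C \<and> finite S \<and> card S = n"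
  proof (cases "finite C")
    case True
    with \<open>?R\<close> have "n \<le> card C" by simp
    then obtain S where "S \<subseteq> C" "card S = n" "finite S" by (rule obtain_subset_with_card_n)
    then show ?thesis by blast
  next
    case False
    then show ?thesis using infinite_arbitrarily_large by blast
  qed
  then obtain S where S: "S \<subseteq> C" "finite S" "card S = n" by blast
  obtain p where p: "bij_betw p {1..n} S"
    using ex_bij_betw_nat_finite_1[OF S(2)] S(3) by blast
  \<comment> \<open>The element 1 keeps \<open>M\<close> nonempty when \<open>n \<le> 1\<close> and
    there are no pairs.\<close>
  define M where "M = insert 1 ((\<lambda>(i, j). dist (p i) (p j)) ` {(i, j) \<in> {1..n} \<times> {1..n}. i \<noteq> j})"
  have "finite {(i, j) \<in> {1..n} \<times> {1..n}. i \<noteq> j}"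
    by (rule finite_subset[of _ "{1..n} \<times> {1..n}"]) auto
  then have fin: "finite M" unfolding M_def by simp
  moreover have "m > 0" if m: "m \<in> M" for m
  proof (cases "m = 1")
    case False
    then obtain i j where "i \<in> {1..n}" "j \<in> {1..n}" "i \<noteq> j" "m = dist (p i) (p j)"
      using m by (force simp: M_def)
    moreover from this have "p i \<noteq> p j" using bij_betw_imp_inj_on[OF p] by (meson inj_onD)
    ultimately show ?thesis by simp
  qed simp
  moreover have "M \<noteq> {}" by (simp add: M_def)
  ultimately have "Min M > 0" by simp
  then obtain k where k: "1 / real (Suc k) < Min M" by (rule nat_approx_posE)
  have "p i \<in> C" if "i \<in> {1..n}" for i
    using bij_betwE[OF p] that S(1) by blast
  moreover have "1 / real (Suc k) \<le> dist (p i) (p j)"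
    if "i \<in> {1..n}" "j \<in> {1..n}" "i \<noteq> j" for i j
  proof -
    have "dist (p i) (p j) \<in> M" using that by (auto simp: M_def)
    then have "Min M \<le> dist (p i) (p j)" using fin by simp
    then show ?thesis using k by linarith
  qed
  ultimately show ?L by (intro exI[of _ k] exI[of _ p]) blast
qed

section \<open>Minimal systems\<close>

locale minimal_system =
  fixes T :: "'a::metric_space \<Rightarrow> 'a"
  assumes minimal: "minimal_tds T"
begin

lemma compact_UNIV: "compact (UNIV :: 'a set)"
  using minimal by (simp add: minimal_tds_def tds_def)

lemma homeo: "homeomorphism UNIV UNIV T (inv T)"
  using minimal by (simp add: minimal_tds_def tds_def)

lemma bij_T: "bij T"
proof (rule o_bij)
  show "inv T \<circ> T = id" "T \<circ> inv T = id"
    using homeo by (auto simp: homeomorphism_def fun_eq_iff)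
qed

lemma bij_funpow_T: "bij (T ^^ n)"
  using bij_T by (rule bij_fn)

lemma inv_T_T [simp]: "inv T (T x) = x" and T_inv_T [simp]: "T (inv T x) = x"
  using bij_T by (simp_all add: bij_is_inj bij_is_surj surj_f_inv_f)

lemma continuous_funpow: "continuous_on UNIV (T ^^ n)"
proof (induction n)
  case 0
  then show ?case by (simp add: id_def)
next
  case (Suc n)
  then show ?case
    using homeo by (auto simp: homeomorphism_def intro: continuous_on_compose2)
qed

lemma continuous_funpow_inv: "continuous_on UNIV (inv T ^^ n)"
proof (induction n)
  case 0
  then show ?case by (simp add: id_def)
next
  case (Suc n)
  then show ?case
    using homeo by (auto simp: homeomorphism_def intro: continuous_on_compose2)
qed

lemma open_vimage_funpow: "open U \<Longrightarrow> open ((T ^^ n) -` U)"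
  by (rule open_vimage[OF _ continuous_funpow])

lemma funpow_inv_funpow: "j \<le> n \<Longrightarrow> (inv T ^^ j) ((T ^^ n) x) = (T ^^ (n - j)) x"
proof (induction j)
  case (Suc j)
  then have "n - j = Suc (n - Suc j)" by simp
  then show ?case using Suc by simp
qed simp

lemma funpow_funpow_inv: "(T ^^ n) ((inv T ^^ n) x) = x"
  by (induction n arbitrary: x) (auto simp: funpow_swap1)

text \<open>Minimality speaks of two-sided orbits, while \<open>F\<close> is only forward invariant.
  But a limit \<open>z\<close> of a forward orbit in \<open>F\<close> has its whole two-sided orbit
  in \<open>F\<close>: each \<open>(inv T ^^ j) z\<close> is a limit of points at the times
  \<open>s k - j\<close>, which eventually stay in the forward orbit.\<close>

lemma closed_forward_invariant_UNIV:
  assumes "closed F" "F \<noteq> {}" and inv: "\<And>x. x \<in> F \<Longrightarrow> T x \<in> F"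
  shows "F = UNIV"
proof -
  have inv_n: "(T ^^ n) x \<in> F" if "x \<in> F" for n x
    using that by (induction n) (auto intro: inv)
  obtain x where x: "x \<in> F" using assms by blast
  obtain z s where s: "strict_mono s" and lim: "(\<lambda>k. (T ^^ s k) x) \<longlonglongrightarrow> z"
    by (rule seq_compactE[OF compact_imp_seq_compact[OF compact_UNIV], of "\<lambda>n. (T ^^ n) x"])
       (auto simp: o_def)
  have "z \<in> F"
    using closed_sequentially[OF \<open>closed F\<close> _ lim] inv_n[OF x] by blast
  moreover have "(inv T ^^ j) z \<in> F" for j
  proof (rule Lim_in_closed_set[OF \<open>closed F\<close>])
    show "((\<lambda>k. (inv T ^^ j) ((T ^^ s k) x)) \<longlongrightarrow> (inv T ^^ j) z) sequentially"
      using continuous_on_tendsto_compose[OF continuous_funpow_inv lim] by simp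
    have "eventually (\<lambda>k. s k \<ge> j) sequentially"
      using s seq_suble by (intro eventually_sequentiallyI[of j]) (meson le_trans)
    then show "eventually (\<lambda>k. (inv T ^^ j) ((T ^^ s k) x) \<in> F) sequentially"
      by eventually_elim (simp add: funpow_inv_funpow inv_n[OF x])
  qed simp
  ultimately have "two_sided_orbit T z \<subseteq> F"
    by (auto simp: two_sided_orbit_def inv_n)
  moreover have "closure (two_sided_orbit T z) = UNIV"
    using minimal by (simp add: minimal_tds_def)
  ultimately show ?thesis
    using closure_minimal[OF _ \<open>closed F\<close>] by blast
qed

text \<open>The points that never visit \<open>U\<close> form a closed forward invariant set which
  misses \<open>U\<close>, so it is empty.\<close>

lemma hits_open:
  assumes "open U" "U \<noteq> {}"
  shows "\<exists>n. (T ^^ n) x \<in> U"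
proof (rule ccontr)
  assume "\<not> ?thesis"
  then have x: "x \<in> (\<Inter>n. - ((T ^^ n) -` U))" by auto
  have "(\<Inter>n. - ((T ^^ n) -` U)) = UNIV"
  proof (rule closed_forward_invariant_UNIV)
    show "closed (\<Inter>n. - ((T ^^ n) -` U))"
      using assms by (intro closed_INT) (auto simp: closed_def open_vimage_funpow)
    show "T y \<in> (\<Inter>n. - ((T ^^ n) -` U))" if "y \<in> (\<Inter>n. - ((T ^^ n) -` U))" for y
    proof
      fix n
      have "(T ^^ Suc n) y \<notin> U" using that by blast
      then show "T y \<in> - ((T ^^ n) -` U)" by (simp add: funpow_swap1)
    qed
  qed (use x in blast)
  moreover obtain u where "u \<in> U" using assms by blast
  ultimately have "u \<in> - ((T ^^ 0) -` U)" by blast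
  then show False using \<open>u \<in> U\<close> by simp
qed

lemma hits_open_uniformly:
  assumes "open U" "U \<noteq> {}"
  obtains L where "\<And>x. \<exists>n\<le>L. (T ^^ n) x \<in> U"
proof -
  have "UNIV \<subseteq> (\<Union>n\<in>UNIV. (T ^^ n) -` U)"
    using hits_open[OF assms] by auto
  then obtain C where C: "finite C" "UNIV \<subseteq> (\<Union>n\<in>C. (T ^^ n) -` U)"
    by (rule compactE_image[OF compact_UNIV, of UNIV "\<lambda>n. (T ^^ n) -` U", rotated])
       (use open_vimage_funpow[OF \<open>open U\<close>] in auto)
  have "\<exists>n\<le>Max C. (T ^^ n) x \<in> U" for x
  proof -
    obtain n where "n \<in> C" "(T ^^ n) x \<in> U" using C(2) by blast
    then show ?thesis using Max_ge[OF \<open>finite C\<close>] by blast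
  qed
  then show ?thesis using that by blast
qed

section \<open>Invariant pseudometrics\<close>

text \<open>The last clause, together with the triangle inequality and symmetry, amounts to
  continuity of \<open>D\<close> on the product space.\<close>

definition invariant_pseudometric :: "('a \<Rightarrow> 'a \<Rightarrow> real) \<Rightarrow> bool" where
  "invariant_pseudometric D \<longleftrightarrow>
     (\<forall>x. D x x = 0) \<and> (\<forall>x y. D x y \<ge> 0) \<and> (\<forall>x y. D x y = D y x) \<and>
     (\<forall>x y z. D x z \<le> D x y + D y z) \<and> (\<forall>x y. D (T x) (T y) = D x y) \<and>
     (\<forall>x. \<forall>e>0. \<exists>V. open V \<and> x \<in> V \<and> (\<forall>y\<in>V. D x y < e))"

lemma invariant_pseudometricD:
  assumes "invariant_pseudometric D"
  shows "D x x = 0" "D x y \<ge> 0" "D x y = D y x" "D x z \<le> D x y + D y z" "D (T x) (T y) = D x y"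
  using assms unfolding invariant_pseudometric_def by simp_all

lemma invariant_pseudometric_small:
  assumes "invariant_pseudometric D" "e > 0"
  shows "\<exists>V. open V \<and> x \<in> V \<and> (\<forall>y\<in>V. D x y < e)"
proof -
  from assms(1) have "\<forall>x. \<forall>e>0. \<exists>V. open V \<and> x \<in> V \<and> (\<forall>y\<in>V. D x y < e)"
    unfolding invariant_pseudometric_def by (elim conjE)
  then show ?thesis using \<open>e > 0\<close> by blast
qed

lemma invariant_pseudometric_funpow:
  "invariant_pseudometric D \<Longrightarrow> D ((T ^^ n) x) ((T ^^ n) y) = D x y"
  by (induction n) (auto simp: invariant_pseudometricD(5))

lemma invariant_pseudometric_zero: "invariant_pseudometric (\<lambda>x y. 0)"
  by (auto simp: invariant_pseudometric_def)

lemma invariant_pseudometric_add: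
  assumes D: "invariant_pseudometric D" and E: "invariant_pseudometric E"
  shows "invariant_pseudometric (\<lambda>x y. D x y + E x y)"
  unfolding invariant_pseudometric_def
proof (intro conjI allI impI)
  fix x y z
  show "D x z + E x z \<le> D x y + E x y + (D y z + E y z)"
    using invariant_pseudometricD(4)[OF D, of x z y] invariant_pseudometricD(4)[OF E, of x z y]
    by linarith
next
  fix x and e :: real assume "e > 0"
  then obtain V W where "open V" "x \<in> V" "\<forall>y\<in>V. D x y < e/2" "open W" "x \<in> W" "\<forall>y\<in>W. E x y < e/2"
    using invariant_pseudometric_small[OF D, of "e/2" x] invariant_pseudometric_small[OF E, of "e/2" x]
    by auto
  then show "\<exists>V. open V \<and> x \<in> V \<and> (\<forall>y\<in>V. D x y + E x y < e)"
    by (intro exI[of _ "V \<inter> W"]) (force intro: open_Int)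
qed (use invariant_pseudometricD[OF D] invariant_pseudometricD[OF E] in \<open>auto simp: add_nonneg_nonneg\<close>)

lemma invariant_pseudometric_sum:
  assumes "finite I" "\<And>i. i \<in> I \<Longrightarrow> invariant_pseudometric (D i)"
  shows "invariant_pseudometric (\<lambda>x y. \<Sum>i\<in>I. D i x y)"
  using assms
  by (induction I rule: finite_induct)
     (auto intro: invariant_pseudometric_zero invariant_pseudometric_add)

lemma invariant_pseudometric_uniform:
  assumes D: "invariant_pseudometric D" and "e > 0"
  obtains d where "d > 0" "\<And>x y. dist x y < d \<Longrightarrow> D x y < e"
proof -
  obtain V where V: "\<And>x. open (V x) \<and> x \<in> V x \<and> (\<forall>y\<in>V x. D x y < e/2)"
    using invariant_pseudometric_small[OF D half_gt_zero[OF \<open>e > 0\<close>]] by metis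
  \<comment> \<open>A Lebesgue number of the cover: \<open>x\<close> and \<open>y\<close> lie in one
    \<open>V z\<close>, hence both within \<open>e/2\<close> of \<open>z\<close>.\<close>
  obtain d where d: "d > 0" "\<And>x. x \<in> UNIV \<Longrightarrow> \<exists>G\<in>range V. ball x d \<subseteq> G"
    by (rule Heine_Borel_lemma[OF compact_UNIV, of "range V"]) (use V in auto)
  have "D x y < e" if "dist x y < d" for x y
  proof -
    obtain z where "ball x d \<subseteq> V z" using d by blast
    then have "D z x < e/2" "D z y < e/2" using V that d(1) by (force simp: subset_iff)+
    then show ?thesis
      using invariant_pseudometricD(3)[OF D, of x z] invariant_pseudometricD(4)[OF D, of x y z]
      by linarith
  qed
  with d(1) show ?thesis using that by blast
qed

text \<open>By invariance \<open>D x' y'\<close> can be measured at time \<open>m\<close>, where the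
  two orbits are close; continuity makes the steps from \<open>x\<close> to \<open>x'\<close> and
  from \<open>y\<close> to \<open>y'\<close> small.\<close>

lemma regionally_proximal_imp_pseudometric_zero:
  assumes D: "invariant_pseudometric D" and Q: "(x, y) \<in> regionally_proximal T"
  shows "D x y = 0"
proof -
  have "D x y \<le> e" if "e > 0" for e
  proof -
    have "e/3 > 0" using that by simp
    then obtain d where d: "d > 0" "\<And>x y. dist x y < d \<Longrightarrow> D x y < e/3"
      using invariant_pseudometric_uniform[OF D] by blast
    obtain x' y' m where *: "dist x x' < d" "dist y y' < d" "dist ((T ^^ m) x') ((T ^^ m) y') < d"
      using Q d(1) unfolding regionally_proximal_def by blast
    have "D x x' < e/3" "D y y' < e/3" "D ((T ^^ m) x') ((T ^^ m) y') < e/3"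
      using d(2)[OF *(1)] d(2)[OF *(2)] d(2)[OF *(3)] .
    moreover have "D x y \<le> D x x' + (D x' y' + D y' y)"
      using invariant_pseudometricD(4)[OF D, of x y x'] invariant_pseudometricD(4)[OF D, of x' y y']
      by linarith
    ultimately show ?thesis
      using invariant_pseudometricD(3)[OF D, of y' y] invariant_pseudometric_funpow[OF D, of m x' y']
      by linarith
  qed
  then have "D x y \<le> 0" by (rule field_le_epsilon) simp
  then show ?thesis
    using invariant_pseudometricD(2)[OF D, of x y] by linarith
qed

end

section \<open>Visit sets under an invariant measure\<close>

locale minimal_measure_system = minimal_system T + prob_space \<mu>
  for T :: "'a::metric_space \<Rightarrow> 'a" and \<mu> :: "'a measure" +
  assumes invariant: "invariant_prob T \<mu>"
begin

lemma sets_mu [simp]: "sets \<mu> = sets borel"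
  using invariant by (simp add: invariant_prob_def)

lemma space_mu [simp]: "space \<mu> = UNIV"
  using sets_eq_imp_space_eq[OF sets_mu] by simp

lemma borel_vimage_funpow: "A \<in> sets borel \<Longrightarrow> (T ^^ n) -` A \<in> sets borel"
  using measurable_sets[OF borel_measurable_continuous_onI[OF continuous_funpow], of A n] by simp

lemma prob_vimage_T: "A \<in> sets borel \<Longrightarrow> prob (T -` A) = prob A"
  using invariant by (simp add: invariant_prob_def measure_def)

lemma prob_vimage_funpow: "A \<in> sets borel \<Longrightarrow> prob ((T ^^ n) -` A) = prob A"
proof (induction n)
  case (Suc n)
  have "(T ^^ Suc n) -` A = T -` ((T ^^ n) -` A)"
    by (auto simp: funpow_swap1)
  then show ?case
    using Suc prob_vimage_T[OF borel_vimage_funpow[OF Suc.prems]] by presburger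
qed (simp add: vimage_def)

lemma borel_pos_iff: "A \<in> borel_pos \<mu> \<longleftrightarrow> A \<in> sets borel \<and> prob A > 0"
  by (auto simp: borel_pos_def emeasure_eq_measure)

text \<open>The preimages of \<open>U\<close> under the iterates of \<open>T\<close> cover the space
  and all have the measure of \<open>U\<close>.\<close>

lemma borel_pos_open:
  assumes "open U" "U \<noteq> {}"
  shows "U \<in> borel_pos \<mu>"
proof -
  have "prob U > 0"
  proof (rule ccontr)
    assume "\<not> ?thesis"
    then have "prob U = 0" using measure_nonneg[of \<mu> U] by linarith
    then have "(T ^^ n) -` U \<in> null_sets \<mu>" for n
      using prob_vimage_funpow[of U n] assms borel_open[of U] borel_vimage_funpow[of U n]
      by (simp add: null_sets_def emeasure_eq_measure)
    then have "(\<Union>n. (T ^^ n) -` U) \<in> null_sets \<mu>" by auto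
    moreover have "(\<Union>n. (T ^^ n) -` U) = UNIV"
      using hits_open[OF assms] by auto
    ultimately show False
      using emeasure_space_1 by (auto simp: null_sets_def)
  qed
  then show ?thesis using assms by (simp add: borel_pos_iff)
qed

definition visits :: "'a set \<Rightarrow> 'a set \<Rightarrow> 'a \<Rightarrow> 'a set" where
  "visits U A x = {z. \<exists>n. (T ^^ n) x \<in> U \<and> (T ^^ n) z \<in> A}"

lemma visits_UN: "visits U A x = (\<Union>n\<in>{n. (T ^^ n) x \<in> U}. (T ^^ n) -` A)"
  by (auto simp: visits_def)

lemma visits_borel [simp, intro]: "A \<in> sets borel \<Longrightarrow> visits U A x \<in> sets borel"
  unfolding visits_UN by (rule sets.countable_UN'') (simp_all add: borel_vimage_funpow)

lemma visits_self: "x \<in> U \<Longrightarrow> A \<subseteq> visits U A x"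
  unfolding visits_def by (metis (mono_tags, lifting) funpow_0 mem_Collect_eq subsetI)

text \<open>Times shift by one; a visit of \<open>x\<close> at time 0 is lost, so only an inclusion
  holds.\<close>

lemma visits_T: "T -` visits U A (T x) \<subseteq> visits U A x"
proof
  fix z assume "z \<in> T -` visits U A (T x)"
  then obtain n where "(T ^^ Suc n) x \<in> U" "(T ^^ Suc n) z \<in> A"
    by (auto simp: visits_def funpow_swap1)
  then show "z \<in> visits U A x" unfolding visits_def by blast
qed

text \<open>Since all visit sets for an open \<open>U\<close> have the same measure, this one-sided
  difference is half the measure of the symmetric difference.\<close>

definition visit_defect :: "'a set \<Rightarrow> 'a set \<Rightarrow> 'a \<Rightarrow> 'a \<Rightarrow> real" where
  "visit_defect U A x y = prob (visits U A x - visits U A y)"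

text \<open>Each single visit of \<open>x\<close> to the open set \<open>U\<close> persists near \<open>x\<close>, and finitely many
  visits exhaust \<^term>\<open>visits U A x\<close> up to small measure.\<close>

lemma visit_defect_small:
  assumes "open U" and A: "A \<in> sets borel" and "e > 0"
  shows "\<exists>V. open V \<and> x \<in> V \<and> (\<forall>y\<in>V. visit_defect U A x y < e)"
proof -
  define B where "B m = (\<Union>n\<in>{n. n < m \<and> (T ^^ n) x \<in> U}. (T ^^ n) -` A)" for m
  have B: "B m \<in> sets borel" for m
    unfolding B_def using A by (intro sets.countable_UN'') (simp_all add: borel_vimage_funpow)
  have "(\<lambda>m. prob (B m)) \<longlonglongrightarrow> prob (\<Union>m. B m)"
  proof (rule finite_Lim_measure_incseq)
    show "range B \<subseteq> events" using B by auto
    show "incseq B" unfolding incseq_def B_def by (force intro: order.strict_trans2)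
  qed
  moreover have "(\<Union>m. B m) = visits U A x"
    unfolding visits_UN B_def by blast
  ultimately obtain m where m: "prob (visits U A x) - e < prob (B m)"
    using \<open>e > 0\<close> by (metis (no_types, lifting) diff_less_eq less_add_same_cancel1 order_tendstoD(1)
        eventually_sequentially order_refl)
  \<comment> \<open>A point of \<open>V\<close> shares all visits of \<open>x\<close> to
    \<open>U\<close> before time \<open>m\<close>, so \<open>B m\<close> lies in both visit
    sets.\<close>
  define V where "V = (\<Inter>n\<in>{n. n < m \<and> (T ^^ n) x \<in> U}. (T ^^ n) -` U)"
  have "open V" unfolding V_def using assms by (intro open_INT) (auto simp: open_vimage_funpow)
  moreover have "x \<in> V" by (auto simp: V_def)
  moreover have "visit_defect U A x y < e" if "y \<in> V" for y
  proof -
    have sub: "B m \<subseteq> visits U A x" unfolding visits_UN B_def by blast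
    have "B m \<subseteq> visits U A y" using that unfolding visits_UN B_def V_def by blast
    then have "visits U A x - visits U A y \<subseteq> visits U A x - B m" by blast
    then have "visit_defect U A x y \<le> prob (visits U A x - B m)"
      unfolding visit_defect_def using visits_borel[OF A] B by (intro finite_measure_mono) auto
    also have "\<dots> = prob (visits U A x) - prob (B m)"
      using visits_borel[OF A] B sub by (intro finite_measure_Diff) auto
    finally show ?thesis using m by linarith
  qed
  ultimately show ?thesis by blast
qed

lemma prob_diff_add:
  assumes "A \<in> sets borel" "B \<in> sets borel"
  shows "prob (A - B) + prob B = prob (B - A) + prob A"
proof -
  have "prob (A - B) = prob A - prob (A \<inter> B)" "prob (B - A) = prob B - prob (A \<inter> B)"
    using assms by (auto simp: finite_measure_Diff' Int_commute)
  then show ?thesis by simp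
qed

text \<open>The sublevel set \<open>F\<close> is closed by lower semicontinuity and forward
  invariant by \<open>visits_T\<close>, so it is everything. Exchanging the two points gives
  equality.\<close>

lemma prob_visits_constant:
  assumes "open U" and A: "A \<in> sets borel"
  shows "prob (visits U A x) = prob (visits U A y)"
proof -
  have "prob (visits U A b) \<le> prob (visits U A a)" for a b
  proof -
    define F where "F = {z. prob (visits U A z) \<le> prob (visits U A a)}"
    have "F = UNIV"
    proof (rule closed_forward_invariant_UNIV)
      have "\<exists>V. open V \<and> z \<in> V \<and> V \<subseteq> - F" if z: "z \<in> - F" for z
      proof -
        define e where "e = prob (visits U A z) - prob (visits U A a)"
        have "e > 0" using z by (simp add: F_def e_def)
        then obtain V where V: "open V" "z \<in> V" "\<forall>y\<in>V. visit_defect U A z y < e"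
          using visit_defect_small[OF assms] by blast
        have "y \<notin> F" if "y \<in> V" for y
        proof -
          have "prob (visits U A z) - prob (visits U A y) \<le> visit_defect U A z y"
            unfolding visit_defect_def
            using prob_diff_add[OF visits_borel[OF A] visits_borel[OF A], of U z U y]
              measure_nonneg[of \<mu> "visits U A y - visits U A z"] by linarith
          then show ?thesis using V(3) that unfolding F_def e_def by force
        qed
        then show ?thesis using V by blast
      qed
      then show "closed F" unfolding closed_def by (subst open_subopen) blast
      show "F \<noteq> {}" by (auto simp: F_def)
      show "T z \<in> F" if "z \<in> F" for z
      proof -
        have "prob (visits U A (T z)) = prob (T -` visits U A (T z))"
          by (rule prob_vimage_T[OF visits_borel[OF A], symmetric])
        also have "\<dots> \<le> prob (visits U A z)"
          using visits_borel[OF A] by (intro finite_measure_mono visits_T) auto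
        finally show ?thesis using that by (simp add: F_def)
      qed
    qed
    then show ?thesis by (auto simp: F_def)
  qed
  then show ?thesis by (meson order_antisym)
qed

lemma visit_defect_pseudometric:
  assumes "open U" and A: "A \<in> sets borel"
  shows "invariant_pseudometric (visit_defect U A)"
  unfolding invariant_pseudometric_def
proof (intro conjI allI impI)
  fix x y z
  show "visit_defect U A x x = 0" "visit_defect U A x y \<ge> 0" by (auto simp: visit_defect_def)
  show "visit_defect U A x y = visit_defect U A y x"
    unfolding visit_defect_def
    using prob_diff_add[OF visits_borel[OF A] visits_borel[OF A], of U x U y]
      prob_visits_constant[OF assms, of x y] by linarith
  have "visit_defect U A x z \<le> prob ((visits U A x - visits U A y) \<union> (visits U A y - visits U A z))"
    unfolding visit_defect_def using visits_borel[OF A] by (intro finite_measure_mono) auto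
  also have "\<dots> \<le> visit_defect U A x y + visit_defect U A y z"
    unfolding visit_defect_def using visits_borel[OF A] by (intro measure_Un_le) auto
  finally show "visit_defect U A x z \<le> visit_defect U A x y + visit_defect U A y z" .
  have T: "T -` visits U A (T u) \<in> sets borel" for u
    using borel_vimage_funpow[of "visits U A (T u)" 1] A by simp
  \<comment> \<open>The inclusion \<open>visits_T\<close> is between sets of equal measure, hence an
    equality up to a null set.\<close>
  have null: "prob (visits U A u - T -` visits U A (T u)) = 0" for u
  proof -
    have "prob (T -` visits U A (T u)) = prob (visits U A u)"
      using prob_visits_constant[OF assms] prob_vimage_T[OF visits_borel[OF A]] by metis
    then show ?thesis
      using A T visits_T by (simp add: finite_measure_Diff)
  qed
  \<comment> \<open>Replacing both sets by others that agree with them up to null sets does not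
    change the measure of the difference; this gives invariance under \<open>T\<close>.\<close>
  have split: "prob (B - C) \<le> prob (B' - C') + (prob (B - B') + prob (C' - C))"
    if [simp]: "B \<in> sets borel" "C \<in> sets borel" "B' \<in> sets borel" "C' \<in> sets borel" for B C B' C'
  proof -
    have "prob (B - C) \<le> prob ((B' - C') \<union> ((B - B') \<union> (C' - C)))"
      by (intro finite_measure_mono) (auto intro!: sets.Un sets.Diff)
    also have "\<dots> \<le> prob (B' - C') + prob ((B - B') \<union> (C' - C))"
      by (intro measure_Un_le) (auto intro!: sets.Un sets.Diff)
    also have "prob ((B - B') \<union> (C' - C)) \<le> prob (B - B') + prob (C' - C)"
      by (intro measure_Un_le) auto
    finally show ?thesis by simp
  qed
  have "visit_defect U A (T x) (T y) = prob (T -` visits U A (T x) - T -` visits U A (T y))"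
    unfolding visit_defect_def using A by (metis prob_vimage_T sets.Diff vimage_Diff visits_borel)
  moreover have "prob (T -` visits U A (T u) - visits U A u) = 0" for u
    using visits_T by (metis Diff_eq_empty_iff measure_empty)
  ultimately show "visit_defect U A (T x) (T y) = visit_defect U A x y"
    using split[of "visits U A x" "visits U A y" "T -` visits U A (T x)" "T -` visits U A (T y)"]
      split[of "T -` visits U A (T x)" "T -` visits U A (T y)" "visits U A x" "visits U A y"]
      null T A
    by (auto simp: visit_defect_def)
next
  fix x and e :: real assume "e > 0"
  then show "\<exists>V. open V \<and> x \<in> V \<and> (\<forall>y\<in>V. visit_defect U A x y < e)"
    using visit_defect_small[OF assms] by blast
qed

text \<open>For \<open>x \<in> U\<close>, time 0 puts \<open>A\<close> inside
  \<open>visits U A x\<close>, and the visit defect of a regionally proximal pair vanishes. So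
  almost every point of \<open>A\<close> returns to \<open>A\<close> at a time when \<open>y\<close>
  is in \<open>U\<close>.\<close>

lemma visits_conull:
  assumes "(x, y) \<in> regionally_proximal T" "open U" "A \<in> sets borel" "x \<in> U"
  shows "prob (A - visits U A y) = 0"
proof -
  have "prob (A - visits U A y) \<le> visit_defect U A x y"
    unfolding visit_defect_def using assms visits_self[of x U A]
    by (intro finite_measure_mono) auto
  also have "\<dots> = 0"
    using assms visit_defect_pseudometric regionally_proximal_imp_pseudometric_zero by blast
  finally show ?thesis using measure_nonneg[of \<mu> "A - visits U A y"] by linarith
qed

section \<open>The regionally proximal relation through pseudometrics\<close>

text \<open>For the converse, visit defects with \<open>A = U\<close> a small ball around
  \<open>y\<close> suffice: some \<open>a \<in> U\<close> is back in \<open>U\<close> together with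
  \<open>x\<close>, so the witnesses are \<open>x\<close> itself and \<open>a\<close>.\<close>

lemma regionally_proximal_iff:
  "(x, y) \<in> regionally_proximal T \<longleftrightarrow> (\<forall>D. invariant_pseudometric D \<longrightarrow> D x y = 0)"
proof
  assume *: "\<forall>D. invariant_pseudometric D \<longrightarrow> D x y = 0"
  have "\<exists>x' y'. \<exists>m::nat. dist x x' < e \<and> dist y y' < e \<and> dist ((T ^^ m) x') ((T ^^ m) y') < e"
    if "e > 0" for e
  proof -
    define U where "U = ball y (e/2)"
    have U: "open U" "y \<in> U" "U \<in> sets borel" using that by (auto simp: U_def)
    have D: "invariant_pseudometric (visit_defect U U)"
      using U by (intro visit_defect_pseudometric)
    have "prob (U - visits U U x) \<le> visit_defect U U y x"
      unfolding visit_defect_def using U visits_self[of y U U]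
      by (intro finite_measure_mono) auto
    moreover have "visit_defect U U y x = 0"
      using * D invariant_pseudometricD(3)[OF D] by metis
    moreover have "prob U > 0"
      using borel_pos_open[OF U(1)] U(2) by (auto simp: borel_pos_iff)
    ultimately obtain a where "a \<in> U" "a \<in> visits U U x"
      by (metis Diff_iff finite_measure_mono leD less_le_trans sets.Diff sets_mu subsetI U(3) visits_borel)
    then obtain n where "a \<in> U" "(T ^^ n) x \<in> U" "(T ^^ n) a \<in> U" by (auto simp: visits_def)
    then have "dist x x < e" "dist y a < e" "dist ((T ^^ n) x) ((T ^^ n) a) < e"
      using that dist_triangle_half_r[of y "(T ^^ n) x" e "(T ^^ n) a"] by (auto simp: U_def)
    then show ?thesis by blast
  qed
  then show "(x, y) \<in> regionally_proximal T" by (simp add: regionally_proximal_def)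
qed (use regionally_proximal_imp_pseudometric_zero in blast)

lemma regionally_proximal_refl: "(x, x) \<in> regionally_proximal T"
  unfolding regionally_proximal_iff by (intro allI impI) (rule invariant_pseudometricD(1))

lemma regionally_proximal_sym:
  "(x, y) \<in> regionally_proximal T \<Longrightarrow> (y, x) \<in> regionally_proximal T"
  unfolding regionally_proximal_iff
proof (intro allI impI)
  fix D assume "\<forall>D. invariant_pseudometric D \<longrightarrow> D x y = 0" and D: "invariant_pseudometric D"
  then show "D y x = 0" using invariant_pseudometricD(3)[OF D, of y x] by auto
qed

lemma regionally_proximal_trans:
  assumes "(x, y) \<in> regionally_proximal T" "(y, z) \<in> regionally_proximal T"
  shows "(x, z) \<in> regionally_proximal T"
  unfolding regionally_proximal_iff
proof (intro allI impI)
  fix D assume D: "invariant_pseudometric D"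
  then have "D x y = 0" "D y z = 0" using assms by (auto simp: regionally_proximal_iff)
  then show "D x z = 0"
    using invariant_pseudometricD(4)[OF D, of x z y] invariant_pseudometricD(2)[OF D, of x z]
    by linarith
qed

lemma regionally_proximal_funpow:
  "((T ^^ n) x, (T ^^ n) y) \<in> regionally_proximal T \<longleftrightarrow> (x, y) \<in> regionally_proximal T"
proof -
  have "D ((T ^^ n) x) ((T ^^ n) y) = 0 \<longleftrightarrow> D x y = 0" if "invariant_pseudometric D" for D
    using invariant_pseudometric_funpow[OF that, of n x y] by simp
  then show ?thesis unfolding regionally_proximal_iff by blast
qed

lemma closed_regionally_proximal: "closed (regionally_proximal T)"
proof -
  have "\<exists>A B. open A \<and> open B \<and> z \<in> A \<times> B \<and> A \<times> B \<subseteq> - regionally_proximal T"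
    if "z \<in> - regionally_proximal T" for z
  proof -
    obtain x y where z: "z = (x, y)" by fastforce
    then have "\<not> (\<forall>D. invariant_pseudometric D \<longrightarrow> D x y = 0)"
      using that by (simp add: regionally_proximal_iff)
    then obtain D where D: "invariant_pseudometric D" "D x y \<noteq> 0" by blast
    then have pos: "D x y / 2 > 0"
      using invariant_pseudometricD(2)[OF D(1), of x y] by linarith
    obtain A where A: "open A" "x \<in> A" "\<forall>u\<in>A. D x u < D x y / 2"
      using invariant_pseudometric_small[OF D(1) pos, of x] by blast
    obtain B where B: "open B" "y \<in> B" "\<forall>v\<in>B. D y v < D x y / 2"
      using invariant_pseudometric_small[OF D(1) pos, of y] by blast
    have "(u, v) \<notin> regionally_proximal T" if "u \<in> A" "v \<in> B" for u v
    proof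
      assume "(u, v) \<in> regionally_proximal T"
      then have "D u v = 0" using D(1) by (auto simp: regionally_proximal_iff)
      moreover have "D x y \<le> D x u + (D u v + D v y)"
        using invariant_pseudometricD(4)[OF D(1), of x y u] invariant_pseudometricD(4)[OF D(1), of u y v]
        by linarith
      moreover have "D x u < D x y / 2" "D y v < D x y / 2" using A B that by auto
      ultimately show False using invariant_pseudometricD(3)[OF D(1), of v y] by linarith
    qed
    then have "A \<times> B \<subseteq> - regionally_proximal T" by auto
    then show ?thesis using A B z by blast
  qed
  then show ?thesis unfolding closed_def by (rule open_prod_intro)
qed

section \<open>Fibres of the factor map\<close>

lemma pi_eq_eq_iff: "pi_eq T x = pi_eq T y \<longleftrightarrow> (x, y) \<in> regionally_proximal T"
proof
  assume "pi_eq T x = pi_eq T y"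
  moreover have "y \<in> pi_eq T y" by (simp add: pi_eq_def regionally_proximal_refl)
  ultimately have "y \<in> pi_eq T x" by simp
  then show "(x, y) \<in> regionally_proximal T" by (simp add: pi_eq_def)
next
  assume "(x, y) \<in> regionally_proximal T"
  then show "pi_eq T x = pi_eq T y"
    unfolding pi_eq_def Image_singleton
    using regionally_proximal_trans regionally_proximal_sym by (intro Collect_cong iffI) meson+
qed

lemma mem_pi_eq_iff: "y \<in> pi_eq T x \<longleftrightarrow> (x, y) \<in> regionally_proximal T"
  by (simp add: pi_eq_def)

lemma pi_eq_fiber: "pi_eq T -` {pi_eq T x} = pi_eq T x"
proof (intro set_eqI)
  fix y
  show "y \<in> pi_eq T -` {pi_eq T x} \<longleftrightarrow> y \<in> pi_eq T x"
    using pi_eq_eq_iff[of x y] mem_pi_eq_iff[of y x] by auto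
qed

lemma pi_eq_funpow: "pi_eq T ((T ^^ n) x) = (T ^^ n) ` pi_eq T x"
proof (intro set_eqI iffI)
  fix y assume "y \<in> pi_eq T ((T ^^ n) x)"
  moreover obtain z where "y = (T ^^ n) z" using surjD[OF bij_is_surj[OF bij_funpow_T]] by blast
  ultimately show "y \<in> (T ^^ n) ` pi_eq T x"
    by (auto simp: mem_pi_eq_iff regionally_proximal_funpow)
qed (auto simp: mem_pi_eq_iff regionally_proximal_funpow)

text \<open>Each point outside \<open>W\<close> is separated from \<open>x\<close> by some
  pseudometric, with a positive bound on a neighbourhood. Finitely many of these neighbourhoods
  cover the compact complement of \<open>W\<close>, and the sum of their pseudometrics serves for
  all.\<close>

lemma pi_eq_neighbourhood:
  assumes "open W" "pi_eq T x \<subseteq> W"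
  obtains D e where "invariant_pseudometric D" "e > 0" "\<And>y. D x y < e \<Longrightarrow> y \<in> W"
proof -
  define good where "good y D V \<longleftrightarrow> invariant_pseudometric D \<and> open V \<and> y \<in> V \<and> D x y > 0 \<and>
    (\<forall>z\<in>V. D x y / 2 < D x z)" for y D V
  have "\<exists>D V. good y D V" if "y \<in> - W" for y
  proof -
    have "(x, y) \<notin> regionally_proximal T" using that assms(2) by (auto simp: mem_pi_eq_iff)
    then have "\<not> (\<forall>D. invariant_pseudometric D \<longrightarrow> D x y = 0)"
      by (simp add: regionally_proximal_iff)
    then obtain D where D: "invariant_pseudometric D" "D x y \<noteq> 0" by blast
    then have pos: "D x y / 2 > 0"
      using invariant_pseudometricD(2)[OF D(1), of x y] by linarith
    obtain V where V: "open V" "y \<in> V" "\<forall>z\<in>V. D y z < D x y / 2"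
      using invariant_pseudometric_small[OF D(1) pos, of y] by blast
    have "D x y / 2 < D x z" if "z \<in> V" for z
    proof -
      have "D y z < D x y / 2" using V that by blast
      then show ?thesis
        using invariant_pseudometricD(4)[OF D(1), of x y z] invariant_pseudometricD(3)[OF D(1), of z y]
        by (simp add: field_simps)
    qed
    then have "good y D V" using D V pos by (auto simp: good_def)
    then show ?thesis by blast
  qed
  then have "\<forall>y\<in>- W. \<exists>D V. good y D V" by blast
  then obtain D where "\<forall>y\<in>- W. \<exists>V. good y (D y) V" using bchoice by metis
  then obtain V where "\<forall>y\<in>- W. good y (D y) (V y)" using bchoice by metis
  then have DV: "\<And>y. y \<in> - W \<Longrightarrow> invariant_pseudometric (D y)"
    "\<And>y. y \<in> - W \<Longrightarrow> open (V y)" "\<And>y. y \<in> - W \<Longrightarrow> y \<in> V y" "\<And>y. y \<in> - W \<Longrightarrow> D y x y > 0"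
    "\<And>y z. y \<in> - W \<Longrightarrow> z \<in> V y \<Longrightarrow> D y x y / 2 < D y x z"
    unfolding good_def by blast+
  have "compact (- W)"
    using compact_Int_closed[OF compact_UNIV, of "- W"] assms(1) by (simp add: closed_def)
  then obtain C where C: "C \<subseteq> - W" "finite C" "- W \<subseteq> (\<Union>y\<in>C. V y)"
    by (rule compactE_image[of "- W" "- W" V]) (use DV(2,3) in blast)+
  \<comment> \<open>The entry 1 covers the case \<open>W = UNIV\<close>, where \<open>C\<close> is
    empty.\<close>
  define e where "e = Min (insert 1 ((\<lambda>y. D y x y / 2) ` C))"
  have "e > 0"
    unfolding e_def using C(1) DV(4) by (subst Min_gr_iff) (auto simp: C(2) subset_iff)
  moreover have ip: "invariant_pseudometric (\<lambda>a b. \<Sum>y\<in>C. D y a b)"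
    by (rule invariant_pseudometric_sum[OF C(2)]) (use C(1) DV(1) in blast)
  moreover have "z \<in> W" if z: "(\<Sum>y\<in>C. D y x z) < e" for z
  proof (rule ccontr)
    assume "z \<notin> W"
    then obtain y where y: "y \<in> C" "z \<in> V y" using C(3) by blast
    then have "D y x y / 2 < D y x z" using DV(5) C(1) by blast
    also have "\<dots> \<le> (\<Sum>y\<in>C. D y x z)"
      by (rule member_le_sum[OF y(1) _ C(2)])
         (use C(1) DV(1) in \<open>blast intro: invariant_pseudometricD(2)\<close>)
    also have "\<dots> < e" by fact
    also have "e \<le> D y x y / 2" unfolding e_def using C(2) y(1) by (intro Min_le) auto
    finally show False by simp
  qed
  ultimately show ?thesis using that by blast
qed

section \<open>Separated points in the fibres\<close>

definition separated :: "nat \<Rightarrow> real \<Rightarrow> 'a set" where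
  "separated n d = {x. \<exists>p :: nat \<Rightarrow> 'a. \<forall>i\<in>{1..n}. (x, p i) \<in> regionally_proximal T \<and>
     (\<forall>j\<in>{1..n}. i \<noteq> j \<longrightarrow> d \<le> dist (p i) (p j))}"

lemma separated_iff_card:
  "(\<exists>k. x \<in> separated n (1 / real (Suc k))) \<longleftrightarrow> infinite (pi_eq T x) \<or> n \<le> card (pi_eq T x)"
  using separated_points_iff_card[of n "pi_eq T x"]
  by (simp only: separated_def mem_pi_eq_iff mem_Collect_eq)

lemma separated_cong:
  assumes "(x, y) \<in> regionally_proximal T"
  shows "x \<in> separated n d \<longleftrightarrow> y \<in> separated n d"
proof -
  have "(x, z) \<in> regionally_proximal T \<longleftrightarrow> (y, z) \<in> regionally_proximal T" for z
    using assms regionally_proximal_sym regionally_proximal_trans by blast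
  then show ?thesis by (simp only: separated_def mem_Collect_eq)
qed

text \<open>The condition is closed in \<open>x\<close> and \<open>p\<close> jointly, and the space
  of all pairs \<open>(x, p)\<close> is compact by Tychonoff, so the projection to \<open>x\<close>
  is compact.\<close>

lemma closed_separated: "closed (separated n d)"
proof -
  define S where "S = (\<Inter>i\<in>{1..n}. {z :: 'a \<times> (nat \<Rightarrow> 'a). (fst z, snd z i) \<in> regionally_proximal T} \<inter>
    (\<Inter>j\<in>{1..n} - {i}. {z. d \<le> dist (snd z i) (snd z j)}))"
  have cont: "continuous_on UNIV (\<lambda>z :: 'a \<times> (nat \<Rightarrow> 'a). snd z i)" for i
    by (rule continuous_on_product_then_coordinatewise) (intro continuous_intros)
  have "closed {z :: 'a \<times> (nat \<Rightarrow> 'a). (fst z, snd z i) \<in> regionally_proximal T}" for i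
  proof -
    have "closed ((\<lambda>z :: 'a \<times> (nat \<Rightarrow> 'a). (fst z, snd z i)) -` regionally_proximal T)"
      by (intro closed_vimage closed_regionally_proximal continuous_intros cont)
    then show ?thesis by (simp add: vimage_def)
  qed
  moreover have "closed {z :: 'a \<times> (nat \<Rightarrow> 'a). d \<le> dist (snd z i) (snd z j)}" for i j
    by (intro closed_Collect_le continuous_intros cont)
  ultimately have "closed S" unfolding S_def by (intro closed_INT ballI closed_Int)
  moreover have "compact (UNIV :: ('a \<times> (nat \<Rightarrow> 'a)) set)"
    using compact_Times[OF compact_UNIV compact_UNIV_fun[OF compact_UNIV, where 'b = nat]] by simp
  ultimately have "compact S"
    using compact_Int_closed by fastforce
  then have "compact (fst ` S)"
    by (intro compact_continuous_image continuous_intros)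
  moreover have "fst ` S = separated n d"
  proof (intro set_eqI iffI)
    fix x assume "x \<in> fst ` S"
    then obtain p where "(x, p) \<in> S" by auto
    then show "x \<in> separated n d"
      unfolding S_def separated_def by (intro CollectI exI[of _ p]) auto
  next
    fix x assume "x \<in> separated n d"
    then obtain p where "\<forall>i\<in>{1..n}. (x, p i) \<in> regionally_proximal T \<and>
        (\<forall>j\<in>{1..n}. i \<noteq> j \<longrightarrow> d \<le> dist (p i) (p j))"
      unfolding separated_def by blast
    then have "(x, p) \<in> S" unfolding S_def by simp
    then show "x \<in> fst ` S" by (rule rev_image_eqI) simp
  qed
  ultimately show ?thesis using compact_imp_closed by metis
qed

lemma Baire_interior:
  fixes F :: "nat \<Rightarrow> 'a set"
  assumes "\<And>k. closed (F k)" "(\<Union>k. F k) = UNIV"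
  obtains k where "interior (F k) \<noteq> {}"
proof -
  have "locally_compact_space (euclidean :: 'a topology)"
    using compact_UNIV
    by (intro compact_imp_locally_compact_space) (simp add: compact_space_def)
  moreover have "regular_space (euclidean :: 'a topology)"
    by (simp add: metrizable_imp_regular_space metrizable_space_euclidean)
  ultimately have "\<exists>k. interior (F k) \<noteq> {}"
    using Baire_category_alt[of euclidean "range F"] assms by fastforce
  then show ?thesis using that by blast
qed

text \<open>By Baire's theorem the points are uniformly separated over some open set; finitely many
  translates of it cover the space.\<close>

lemma uniformly_separated:
  assumes "\<And>x. infinite (pi_eq T x) \<or> n \<le> card (pi_eq T x)"
  obtains d where "d > 0" "\<And>x. x \<in> separated n d"
proof -
  obtain k where k: "interior (separated n (1 / real (Suc k))) \<noteq> {}"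
  proof (rule Baire_interior)
    show "closed (separated n (1 / real (Suc k)))" for k by (rule closed_separated)
    show "(\<Union>k. separated n (1 / real (Suc k))) = UNIV"
    proof (rule UNIV_eq_I[symmetric])
      fix x
      obtain k where "x \<in> separated n (1 / real (Suc k))"
        using assms[of x] unfolding separated_iff_card[symmetric] by (rule exE)
      then show "x \<in> (\<Union>k. separated n (1 / real (Suc k)))" by (rule UN_I[OF UNIV_I])
    qed
  qed blast
  obtain L where L: "\<And>x. \<exists>m\<le>L. (T ^^ m) x \<in> interior (separated n (1 / real (Suc k)))"
    using hits_open_uniformly[OF open_interior k] by blast
  have "\<exists>d>0. \<forall>u v. dist u v < d \<longrightarrow> dist ((T ^^ m) u) ((T ^^ m) v) < 1 / real (Suc k)" for m
    using compact_uniformly_continuous[OF continuous_funpow compact_UNIV, of m]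
    unfolding uniformly_continuous_on_def by (simp add: dist_commute)
  then obtain g where g: "\<And>m. g m > 0"
    "\<And>m u v. dist u v < g m \<Longrightarrow> dist ((T ^^ m) u) ((T ^^ m) v) < 1 / real (Suc k)"
    by metis
  \<comment> \<open>Points closer than \<open>d\<close> have images closer than
    \<open>1 / real (Suc k)\<close> under every \<open>T ^^ m\<close> with \<open>m \<le> L\<close>;
    thus the separation found at time \<open>m\<close> pulls back to separation
    \<open>d\<close>.\<close>
  define d where "d = Min (g ` {..L})"
  have d: "d > 0" "\<And>m. m \<le> L \<Longrightarrow> d \<le> g m"
    unfolding d_def using g(1) by (auto simp: Min_gr_iff)
  have "x \<in> separated n d" for x
  proof -
    obtain m where m: "m \<le> L" "(T ^^ m) x \<in> separated n (1 / real (Suc k))"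
      using L[of x] interior_subset by blast
    then obtain p where p: "\<forall>i\<in>{1..n}. ((T ^^ m) x, p i) \<in> regionally_proximal T \<and>
        (\<forall>j\<in>{1..n}. i \<noteq> j \<longrightarrow> 1 / real (Suc k) \<le> dist (p i) (p j))"
      unfolding separated_def by blast
    define q where "q i = (inv T ^^ m) (p i)" for i
    have q: "(T ^^ m) (q i) = p i" for i by (simp add: q_def funpow_funpow_inv)
    have "(x, q i) \<in> regionally_proximal T" if "i \<in> {1..n}" for i
      using p that regionally_proximal_funpow[of m x "q i"] by (simp add: q)
    moreover have "d \<le> dist (q i) (q j)" if "i \<in> {1..n}" "j \<in> {1..n}" "i \<noteq> j" for i j
    proof (rule ccontr)
      assume "\<not> ?thesis"
      then have "dist (q i) (q j) < g m" using d(2)[OF m(1)] by linarith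
      then have "dist (p i) (p j) < 1 / real (Suc k)" using g(2) q by metis
      moreover have "1 / real (Suc k) \<le> dist (p i) (p j)" using p that by blast
      ultimately show False by linarith
    qed
    ultimately show ?thesis unfolding separated_def by (intro CollectI exI[of _ q]) blast
  qed
  with d(1) show ?thesis using that by blast
qed

section \<open>Simultaneous visits\<close>

text \<open>Adding one index \<open>i\<close>: as \<open>x\<close> and \<open>q i\<close> are regionally proximal, almost all of \<open>B\<close> lies in
  \<^term>\<open>visits (U i) B x\<close>, so some visit time \<open>m\<close> of \<open>x\<close> to \<open>U i\<close> returns a subset of \<open>B\<close> of
  positive measure to \<open>B\<close>.\<close>

lemma common_visits:
  assumes "finite I" "A \<in> borel_pos \<mu>"
    and "\<And>i. i \<in> I \<Longrightarrow> open (U i) \<and> q i \<in> U i \<and> (x, q i) \<in> regionally_proximal T"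
  shows "\<exists>B n. B \<in> borel_pos \<mu> \<and> B \<subseteq> A \<and>
    (\<forall>i\<in>I. (T ^^ n i) x \<in> U i \<and> (\<forall>b\<in>B. (T ^^ n i) b \<in> A))"
  using assms(1,3)
proof (induction I rule: finite_induct)
  case empty
  then show ?case using assms(2) by blast
next
  case (insert i I)
  then obtain B n where B: "B \<in> borel_pos \<mu>" "B \<subseteq> A"
    and n: "\<forall>i\<in>I. (T ^^ n i) x \<in> U i \<and> (\<forall>b\<in>B. (T ^^ n i) b \<in> A)"
    by (metis insertI2)
  have i: "open (U i)" "q i \<in> U i" "(q i, x) \<in> regionally_proximal T"
    using insert.prems[of i] regionally_proximal_sym by auto
  have Bs: "B \<in> sets borel" "prob B > 0" using B(1) by (simp_all add: borel_pos_iff)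
  define R where "R m = B \<inter> (T ^^ m) -` B" for m
  have R: "R m \<in> sets borel" for m
    unfolding R_def using Bs borel_vimage_funpow by blast
  have "\<exists>m. (T ^^ m) x \<in> U i \<and> prob (R m) > 0"
  proof (rule ccontr)
    assume "\<not> ?thesis"
    then have "R m \<in> null_sets \<mu>" if "(T ^^ m) x \<in> U i" for m
      using that R measure_nonneg[of \<mu> "R m"]
      by (metis emeasure_eq_measure ennreal_0 less_le null_setsI sets_mu)
    then have "(\<Union>m\<in>{m. (T ^^ m) x \<in> U i}. R m) \<in> null_sets \<mu>"
      by (intro null_sets_UN') auto
    moreover have "B - visits (U i) B x \<in> null_sets \<mu>"
      using visits_conull[OF i(3,1) Bs(1) i(2)] Bs(1)
      by (intro null_setsI) (auto simp: emeasure_eq_measure)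
    ultimately have "(\<Union>m\<in>{m. (T ^^ m) x \<in> U i}. R m) \<union> (B - visits (U i) B x) \<in> null_sets \<mu>"
      by (rule null_sets.Un)
    moreover have "B \<subseteq> (\<Union>m\<in>{m. (T ^^ m) x \<in> U i}. R m) \<union> (B - visits (U i) B x)"
      unfolding visits_UN R_def by blast
    ultimately have "B \<in> null_sets \<mu>" using null_sets_subset Bs(1) sets_mu by blast
    then show False using Bs(2) by (simp add: null_sets_def emeasure_eq_measure)
  qed
  then obtain m where m: "(T ^^ m) x \<in> U i" "prob (R m) > 0" by blast
  have "R m \<in> borel_pos \<mu>" using R m by (simp add: borel_pos_iff)
  moreover have "R m \<subseteq> A" using B by (auto simp: R_def)
  \<comment> \<open>Old indices keep their times since \<open>R m \<subseteq> B\<close>; for the new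
    one, \<open>T ^^ m\<close> carries \<open>R m\<close> into
    \<open>B \<subseteq> A\<close>.\<close>
  moreover have "\<forall>j\<in>insert i I. (T ^^ (n(i := m)) j) x \<in> U j \<and> (\<forall>b\<in>R m. (T ^^ (n(i := m)) j) b \<in> A)"
    using n m B by (auto simp: R_def)
  ultimately show ?case by blast
qed

text \<open>To control the times \<open>s, \<dots>, s + k\<close> together, the separated points of the fibres over
  \<open>T\<^sup>j x\<close>, for \<open>j \<le> k\<close>, are all pulled back to the fibre of \<open>x\<close>.\<close>

lemma thickly_syndetic_N_T:
  assumes d: "d > 0" "\<And>x. x \<in> separated r d" and A: "A \<in> borel_pos \<mu>"
  shows "thickly_syndetic (N_T T A (d/2) r)"
  unfolding thickly_syndetic_def
proof (intro allI impI)
  fix k :: nat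
  \<comment> \<open>An arbitrary base point.\<close>
  define x :: 'a where "x = undefined"
  have "\<forall>j. \<exists>p :: nat \<Rightarrow> 'a. \<forall>i\<in>{1..r}. ((T ^^ j) x, p i) \<in> regionally_proximal T \<and>
     (\<forall>i'\<in>{1..r}. i \<noteq> i' \<longrightarrow> d \<le> dist (p i) (p i'))"
    using d(2) unfolding separated_def by blast
  from choice[OF this] obtain p where p: "\<And>j. \<forall>i\<in>{1..r}. ((T ^^ j) x, p j i) \<in> regionally_proximal T \<and>
     (\<forall>i'\<in>{1..r}. i \<noteq> i' \<longrightarrow> d \<le> dist (p j i :: 'a) (p j i'))"
    by blast
  define I where "I = {..k} \<times> {1..r}"
  define q where "q = (\<lambda>(j, i). (inv T ^^ j) (p j i))"
  \<comment> \<open>With radius \<open>d/4\<close>, points of the balls around \<open>p j i\<close>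
    and \<open>p j i'\<close> are more than \<open>d/2\<close> apart for
    \<open>i \<noteq> i'\<close>.\<close>
  define U where "U = (\<lambda>(j, i). (T ^^ j) -` ball (p j i) (d/4))"
  have fin: "finite I" by (simp add: I_def)
  have U: "open (U \<iota>) \<and> q \<iota> \<in> U \<iota> \<and> (x, q \<iota>) \<in> regionally_proximal T" if "\<iota> \<in> I" for \<iota>
  proof -
    obtain j i where ji: "\<iota> = (j, i)" "i \<in> {1..r}" using \<open>\<iota> \<in> I\<close> by (auto simp: I_def)
    have "(T ^^ j) (q \<iota>) = p j i" by (simp add: ji q_def funpow_funpow_inv)
    moreover have "((T ^^ j) x, p j i) \<in> regionally_proximal T" using p ji by blast
    ultimately have "(x, q \<iota>) \<in> regionally_proximal T" "q \<iota> \<in> U \<iota>"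
      using regionally_proximal_funpow[of j x "q \<iota>"] d(1) by (simp_all add: ji U_def)
    moreover have "open (U \<iota>)" by (simp add: ji U_def open_vimage_funpow)
    ultimately show ?thesis by blast
  qed
  obtain B n where B: "B \<in> borel_pos \<mu>"
    and n: "\<forall>\<iota>\<in>I. (T ^^ n \<iota>) x \<in> U \<iota> \<and> (\<forall>b\<in>B. (T ^^ n \<iota>) b \<in> A)"
    using common_visits[of I A U q x, OF fin A U] by blast
  have "B \<noteq> {}" using B by (auto simp: borel_pos_iff)
  then obtain b where b: "b \<in> B" by blast
  define V where "V = (\<Inter>\<iota>\<in>I. (T ^^ n \<iota>) -` U \<iota>)"
  have "open V" unfolding V_def using fin U open_vimage_funpow by (intro open_INT) simp_all
  moreover have "x \<in> V" unfolding V_def using n by blast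
  ultimately obtain L where L: "\<And>y. \<exists>m\<le>L. (T ^^ m) y \<in> V"
    using hits_open_uniformly[of V] by blast
  have N: "{s..s + k} \<subseteq> N_T T A (d/2) r" if s: "(T ^^ s) b \<in> V" "s \<ge> 1" for s
  proof
    fix t assume t: "t \<in> {s..s + k}"
    define j where "j = t - s"
    have j: "j \<le> k" "t = j + s" using t by (auto simp: j_def)
    \<comment> \<open>\<open>T ^^ n (j, i)\<close> brings \<open>b\<close> into \<open>A\<close>,
      and it brings \<open>(T ^^ s) b\<close>, which lies in \<open>V\<close>, into
      \<open>U (j, i)\<close>. As the iterates commute, \<open>j\<close> further steps lead to the
      ball around \<open>p j i\<close> at time \<open>t = j + s\<close>.\<close>
    define y where "y i = (T ^^ n (j, i)) b" for i
    have y: "y i \<in> A" "dist (p j i) ((T ^^ t) (y i)) < d/4" if "i \<in> {1..r}" for i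
    proof -
      have I: "(j, i) \<in> I" using that j by (simp add: I_def)
      then show "y i \<in> A" using n b by (simp add: y_def)
      have "(T ^^ n (j, i)) ((T ^^ s) b) \<in> U (j, i)" using s(1) I unfolding V_def by blast
      moreover have "(T ^^ j) ((T ^^ n (j, i)) ((T ^^ s) b)) = (T ^^ t) (y i)"
      proof -
        have "(T ^^ j) ((T ^^ n (j, i)) ((T ^^ s) b)) = (T ^^ (j + n (j, i) + s)) b"
          by (simp add: funpow_add)
        also have "j + n (j, i) + s = t + n (j, i)" using j(2) by simp
        also have "(T ^^ (t + n (j, i))) b = (T ^^ t) (y i)" by (simp add: funpow_add y_def)
        finally show ?thesis .
      qed
      ultimately show "dist (p j i) ((T ^^ t) (y i)) < d/4" by (simp add: U_def)
    qed
    have "dist ((T ^^ t) (y i)) ((T ^^ t) (y i')) > d/2"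
      if i: "i \<in> {1..r}" "i' \<in> {1..r}" "i \<noteq> i'" for i i'
    proof -
      have "d \<le> dist (p j i) (p j i')" using p i by blast
      also have "\<dots> \<le> dist (p j i) ((T ^^ t) (y i)) + dist ((T ^^ t) (y i)) ((T ^^ t) (y i'))
          + dist (p j i') ((T ^^ t) (y i'))"
        using dist_triangle[of "p j i" "p j i'" "(T ^^ t) (y i)"]
          dist_triangle[of "(T ^^ t) (y i)" "p j i'" "(T ^^ t) (y i')"]
        by (simp add: dist_commute)
      finally show ?thesis using y(2)[OF i(1)] y(2)[OF i(2)] by (simp add: field_simps)
    qed
    then show "t \<in> N_T T A (d/2) r"
      unfolding N_T_def using y(1) s(2) j(2) by (intro CollectI conjI exI[of _ y]) auto
  qed
  have "{m..m + Suc L} \<inter> {s. {s..s + k} \<subseteq> N_T T A (d/2) r} \<noteq> {}" if "m \<ge> 1" for m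
  proof -
    obtain l where l: "l \<le> L" "(T ^^ l) ((T ^^ m) b) \<in> V" using L by blast
    then have "(T ^^ (l + m)) b \<in> V" by (simp add: funpow_add)
    then have "l + m \<in> {s. {s..s + k} \<subseteq> N_T T A (d/2) r}"
      using that by (intro CollectI N) auto
    moreover have "l + m \<in> {m..m + Suc L}" using l(1) by simp
    ultimately show ?thesis by blast
  qed
  then show "syndetic {s. {s..s + k} \<subseteq> N_T T A (d/2) r}"
    unfolding syndetic_def by (intro exI[of _ "Suc L"]) auto
qed

text \<open>A fibre with fewer than \<open>r\<close> points lies in fewer than \<open>r\<close> balls of radius \<open>\<delta>/2\<close>; by
  equicontinuity a small neighbourhood of it returns into these balls syndetically often.\<close>

lemma thickly_sensitive_imp_large_fibers:
  assumes "thickly_sensitive T \<mu> r"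
  shows "infinite (pi_eq T x) \<or> r \<le> card (pi_eq T x)"
proof (rule ccontr)
  assume "\<not> ?thesis"
  then have C: "finite (pi_eq T x)" "card (pi_eq T x) < r" by auto
  obtain \<delta> where \<delta>: "\<delta> > 0" "\<And>U. U \<in> borel_pos \<mu> \<Longrightarrow> thick (N_T T U \<delta> r)"
    using assms unfolding thickly_sensitive_def by blast
  define W where "W = (\<Union>c\<in>pi_eq T x. ball c (\<delta>/2))"
  have "open W" unfolding W_def by blast
  moreover have "pi_eq T x \<subseteq> W" unfolding W_def using \<delta>(1) by auto
  ultimately obtain D e where D: "invariant_pseudometric D" and "e > 0"
    and DW: "\<And>y. D x y < e \<Longrightarrow> y \<in> W"
    by (rule pi_eq_neighbourhood) blast
  obtain V where V: "open V" "x \<in> V" "\<forall>y\<in>V. D x y < e/2"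
    using invariant_pseudometric_small[OF D half_gt_zero[OF \<open>e > 0\<close>]] by blast
  obtain L where L: "\<And>y. \<exists>m\<le>L. (T ^^ m) y \<in> V"
    using hits_open_uniformly[of V] V by blast
  have "V \<in> borel_pos \<mu>" using V by (intro borel_pos_open) auto
  then have "thick (N_T T V \<delta> r)" by (rule \<delta>(2))
  \<comment> \<open>A run longer than \<open>L\<close> contains a time \<open>t\<close> at which
    \<open>x\<close> is in \<open>V\<close>.\<close>
  then obtain n where n: "{n..n + Suc L} \<subseteq> N_T T V \<delta> r"
    unfolding thick_def by (metis Suc_eq_plus1 le_add2)
  obtain l where l: "l \<le> L" "(T ^^ l) ((T ^^ n) x) \<in> V" using L by blast
  define t where "t = l + n"
  have tV: "(T ^^ t) x \<in> V" using l(2) by (simp add: t_def funpow_add)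
  have "t \<in> N_T T V \<delta> r" using n l(1) by (auto simp: t_def)
  then obtain y where y: "\<forall>i\<in>{1..r}. y i \<in> V"
    "\<forall>i\<in>{1..r}. \<forall>j\<in>{1..r}. i \<noteq> j \<longrightarrow> dist ((T ^^ t) (y i)) ((T ^^ t) (y j)) > \<delta>"
    unfolding N_T_def by blast
  have "\<exists>c. c \<in> pi_eq T x \<and> dist c ((T ^^ t) (y i)) < \<delta>/2" if "i \<in> {1..r}" for i
  proof -
    have "D x (y i) < e/2" "D x ((T ^^ t) x) < e/2" using V(3) y(1) tV that by auto
    \<comment> \<open>Invariance keeps \<open>(T ^^ t) (y i)\<close> within \<open>e/2\<close> of
      \<open>(T ^^ t) x\<close>, which is itself within \<open>e/2\<close> of
      \<open>x\<close>.\<close>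
    then have "D x ((T ^^ t) (y i)) < e"
      using invariant_pseudometricD(4)[OF D, of x "(T ^^ t) (y i)" "(T ^^ t) x"]
        invariant_pseudometric_funpow[OF D, of t x "y i"] by linarith
    then have "(T ^^ t) (y i) \<in> W" by (rule DW)
    then show ?thesis unfolding W_def by auto
  qed
  then obtain c where c: "\<And>i. i \<in> {1..r} \<Longrightarrow> c i \<in> pi_eq T x"
    "\<And>i. i \<in> {1..r} \<Longrightarrow> dist (c i) ((T ^^ t) (y i)) < \<delta>/2" by metis
  have "c ` {1..r} \<subseteq> pi_eq T x" using c(1) by blast
  from card_mono[OF C(1) this] have "card (c ` {1..r}) < card {1..r}"
    using C(2) by simp
  then have "\<not> inj_on c {1..r}" by (rule pigeonhole)
  then obtain i j where ij: "i \<in> {1..r}" "j \<in> {1..r}" "i \<noteq> j" "c i = c j"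
    unfolding inj_on_def by blast
  have "dist ((T ^^ t) (y i)) ((T ^^ t) (y j)) < \<delta>"
    using c(2)[OF ij(1)] c(2)[OF ij(2)] ij(4) by (metis dist_commute dist_triangle_half_r)
  moreover have "dist ((T ^^ t) (y i)) ((T ^^ t) (y j)) > \<delta>" using y(2) ij by blast
  ultimately show False by simp
qed

section \<open>Almost finite-to-one extensions\<close>

lemma card_pi_eq_funpow: "card (pi_eq T ((T ^^ n) x)) = card (pi_eq T x)"
  unfolding pi_eq_funpow by (rule card_image) (rule inj_on_subset[OF bij_is_inj[OF bij_funpow_T] subset_UNIV])

text \<open>As \<open>c\<close> is least, a fibre has exactly \<open>c\<close> points iff it has no
  \<open>Suc c\<close> separated points at any scale: a countable intersection of open conditions.
  The orbit of \<open>x\<close> consists of such points and meets every nonempty open set, which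
  gives density.\<close>

lemma almost_to_one_pi_eq:
  assumes x: "finite (pi_eq T x)" "card (pi_eq T x) = c"
    and least: "\<And>y. finite (pi_eq T y) \<Longrightarrow> c \<le> card (pi_eq T y)"
  shows "almost_to_one c (X_eq T) (pi_eq T)"
proof -
  define A where "A = {C \<in> range (pi_eq T). finite C \<and> card C = c}"
  define G where "G k = pi_eq T ` (- separated (Suc c) (1 / real (Suc k)))" for k
  have vG: "pi_eq T -` G k = - separated (Suc c) (1 / real (Suc k))" for k
  proof (intro set_eqI iffI)
    fix y assume "y \<in> pi_eq T -` G k"
    then obtain z where z: "z \<notin> separated (Suc c) (1 / real (Suc k))" "pi_eq T y = pi_eq T z"
      unfolding G_def by blast
    then show "y \<in> - separated (Suc c) (1 / real (Suc k))"
      using separated_cong pi_eq_eq_iff by blast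
  qed (auto simp: G_def)
  have "openin (X_eq T) (G k)" for k
    unfolding openin_X_eq vG
    using closed_separated by (auto simp: open_closed G_def range_pi_eq[symmetric])
  then have "gdelta_in (X_eq T) (\<Inter>(range G))"
    by (intro gdelta_in_Inter) (auto intro: open_imp_gdelta_in)
  moreover have "\<Inter>(range G) = A"
  proof (intro set_eqI iffI)
    fix C assume "C \<in> \<Inter>(range G)"
    then have CG: "C \<in> G k" for k by blast
    then obtain y where y: "C = pi_eq T y" unfolding G_def by blast
    have "y \<notin> separated (Suc c) (1 / real (Suc k))" for k
      using CG[of k] vG[of k] y by blast
    then have "\<not> (infinite (pi_eq T y) \<or> Suc c \<le> card (pi_eq T y))"
      by (simp only: separated_iff_card[symmetric]) blast
    then have "finite C" "card C \<le> c" by (auto simp: y)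
    then show "C \<in> A" using least[of y] by (auto simp: A_def y)
  next
    fix C assume "C \<in> A"
    then obtain y where y: "C = pi_eq T y" "finite (pi_eq T y)" "card (pi_eq T y) = c"
      by (auto simp: A_def)
    then have "\<not> (\<exists>k. y \<in> separated (Suc c) (1 / real (Suc k)))"
      unfolding separated_iff_card by simp
    then show "C \<in> \<Inter>(range G)" unfolding G_def y(1) by blast
  qed
  ultimately have "gdelta_in (X_eq T) A" by simp
  moreover have "X_eq T closure_of A = topspace (X_eq T)"
  proof (intro subset_antisym closure_of_subset_topspace subsetI)
    fix C assume C: "C \<in> topspace (X_eq T)"
    have "\<exists>y. y \<in> A \<and> y \<in> V" if V: "C \<in> V" "openin (X_eq T) V" for V
    proof -
      obtain z where "C = pi_eq T z" using C by (auto simp: topspace_X_eq range_pi_eq[symmetric])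
      then have "open (pi_eq T -` V)" "pi_eq T -` V \<noteq> {}"
        using V by (auto simp: openin_X_eq)
      then obtain n where n: "(T ^^ n) x \<in> pi_eq T -` V" using hits_open by blast
      have "pi_eq T ((T ^^ n) x) \<in> A"
      proof -
        have "finite (pi_eq T ((T ^^ n) x))" using x(1) by (simp add: pi_eq_funpow)
        then show ?thesis using x(2) card_pi_eq_funpow[of n x] by (simp add: A_def)
      qed
      then show ?thesis using n by blast
    qed
    then show "C \<in> X_eq T closure_of A" using C by (simp add: in_closure_of)
  qed
  moreover have "finite (pi_eq T -` {C}) \<and> card (pi_eq T -` {C}) = c" if "C \<in> A" for C
    using that by (auto simp: A_def pi_eq_fiber)
  ultimately show ?thesis unfolding almost_to_one_def by blast
qed

text \<open>If some fibre has fewer than \<open>r\<close> points, the least cardinality of a finite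
  fibre is a forbidden \<open>m\<close>. Conversely, a dense set is nonempty and provides a fibre
  with \<open>m < r\<close> points.\<close>

lemma not_almost_to_one_iff:
  "(\<forall>m\<in>{1..r - 1}. \<not> almost_to_one m (X_eq T) (pi_eq T)) \<longleftrightarrow>
    (\<forall>x. infinite (pi_eq T x) \<or> r \<le> card (pi_eq T x))"
proof (intro iffI allI ballI notI)
  fix m assume large: "\<forall>x. infinite (pi_eq T x) \<or> r \<le> card (pi_eq T x)"
    and m: "m \<in> {1..r - 1}" and "almost_to_one m (X_eq T) (pi_eq T)"
  then obtain A where A: "gdelta_in (X_eq T) A" "X_eq T closure_of A = topspace (X_eq T)"
    "\<forall>y\<in>A. finite (pi_eq T -` {y}) \<and> card (pi_eq T -` {y}) = m"
    unfolding almost_to_one_def by blast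
  have "topspace (X_eq T) \<noteq> {}" by (simp add: topspace_X_eq flip: range_pi_eq)
  moreover have "X_eq T closure_of {} = {}" by simp
  ultimately have "A \<noteq> {}" using A(2) by metis
  then obtain C where "C \<in> A" by blast
  moreover from this obtain x where "C = pi_eq T x"
    using gdelta_in_subset[OF A(1)] by (auto simp: topspace_X_eq range_pi_eq[symmetric])
  ultimately have "finite (pi_eq T x)" "card (pi_eq T x) = m" using A(3) by (auto simp: pi_eq_fiber)
  then show False using large m by fastforce
next
  fix x assume *: "\<forall>m\<in>{1..r - 1}. \<not> almost_to_one m (X_eq T) (pi_eq T)"
  show "infinite (pi_eq T x) \<or> r \<le> card (pi_eq T x)"
  proof (rule ccontr)
    assume "\<not> ?thesis"
    then have x: "finite (pi_eq T x)" "card (pi_eq T x) < r" by auto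
    define c where "c = (LEAST c. \<exists>y. finite (pi_eq T y) \<and> card (pi_eq T y) = c)"
    have "\<exists>y. finite (pi_eq T y) \<and> card (pi_eq T y) = c"
      unfolding c_def by (rule LeastI_ex) (use x(1) in blast)
    then obtain y where y: "finite (pi_eq T y)" "card (pi_eq T y) = c" by blast
    have least: "c \<le> card (pi_eq T z)" if "finite (pi_eq T z)" for z
      unfolding c_def by (rule Least_le) (use that in blast)
    have "almost_to_one c (X_eq T) (pi_eq T)"
      using y least by (rule almost_to_one_pi_eq)
    moreover have "y \<in> pi_eq T y" by (simp add: mem_pi_eq_iff regionally_proximal_refl)
    then have "c \<noteq> 0" using y card_gt_0_iff[of "pi_eq T y"] by auto
    then have "c \<in> {1..r - 1}" using least[OF x(1)] x(2) by auto
    ultimately show False using * by blast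
  qed
qed

section \<open>Comparing the notions of sensitivity\<close>

text \<open>A time \<open>n\<close> common to \<open>A\<close> and its first \<open>k\<close>
  forward images under \<open>T\<close> yields the whole block from \<open>n\<close> to
  \<open>n + k\<close> for \<open>A\<close>.\<close>

lemma multi_sensitive_imp_thickly_sensitive:
  assumes "multi_sensitive T \<mu> r"
  shows "thickly_sensitive T \<mu> r"
proof -
  obtain \<delta> where \<delta>: "\<delta> > 0" "\<forall>k\<ge>1::nat. \<forall>U. (\<forall>i\<in>{1..k}. U i \<in> borel_pos \<mu>) \<longrightarrow>
      (\<Inter>i\<in>{1..k}. N_T T (U i) \<delta> r) \<noteq> {}"
    using assms unfolding multi_sensitive_def by (elim exE conjE) (rule that)
  have "thick (N_T T A \<delta> r)" if A: "A \<in> borel_pos \<mu>" for A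
    unfolding thick_def
  proof (intro allI impI)
    fix k :: nat
    \<comment> \<open>This is the image of \<open>A\<close> under \<open>T ^^ (i - 1)\<close>; the
      shift by one makes \<open>U 1 = A\<close>.\<close>
    define U where "U i = (inv T ^^ (i - 1)) -` A" for i
    have "U i \<in> borel_pos \<mu>" for i
    proof -
      have "U i \<in> sets borel"
        using measurable_sets[OF borel_measurable_continuous_onI[OF continuous_funpow_inv], of A]
          A by (simp add: U_def borel_pos_iff)
      moreover have "(T ^^ (i - 1)) -` U i = A"
        using funpow_inv_funpow[of "i - 1" "i - 1"] by (auto simp: U_def)
      ultimately show ?thesis
        using prob_vimage_funpow[of "U i" "i - 1"] A by (simp add: borel_pos_iff)
    qed
    then have "(\<Inter>i\<in>{1..Suc k}. N_T T (U i) \<delta> r) \<noteq> {}"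
      by (intro \<delta>(2)[rule_format, of "Suc k" U]) simp_all
    then obtain n where n: "\<And>i. i \<in> {1..Suc k} \<Longrightarrow> n \<in> N_T T (U i) \<delta> r" by blast
    have "t \<in> N_T T A \<delta> r" if t: "t \<in> {n..n + k}" for t
    proof -
      define i where "i = Suc (t - n)"
      have i: "i \<in> {1..Suc k}" "t = n + (i - 1)" using t by (auto simp: i_def)
      obtain x where x: "n \<ge> 1" "\<forall>j\<in>{1..r}. x j \<in> U i"
        "\<forall>j\<in>{1..r}. \<forall>j'\<in>{1..r}. j \<noteq> j' \<longrightarrow> dist ((T ^^ n) (x j)) ((T ^^ n) (x j')) > \<delta>"
        using n[OF i(1)] unfolding N_T_def by blast
      define y where "y j = (inv T ^^ (i - 1)) (x j)" for j
      have "(T ^^ t) (y j) = (T ^^ n) (x j)" for j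
        by (simp add: i(2) funpow_add y_def funpow_funpow_inv)
      moreover have "y j \<in> A" if "j \<in> {1..r}" for j using x(2) that by (simp add: U_def y_def)
      ultimately show ?thesis
        unfolding N_T_def using x(1,3) i(2) by (intro CollectI conjI exI[of _ y]) auto
    qed
    moreover have "n \<ge> 1" using n[of 1] by (simp add: N_T_def)
    ultimately show "\<exists>n\<ge>1. {n..n + k} \<subseteq> N_T T A \<delta> r" by blast
  qed
  then show ?thesis unfolding thickly_sensitive_def using \<delta>(1) by blast
qed

end

section \<open>Thickly syndetic sets\<close>

text \<open>If \<open>L\<close> bounds the gaps between starts of blocks in \<open>B\<close>, then
  every longer block in \<open>A\<close>, of length parameter \<open>L + k\<close>, contains a
  complete block of \<open>B\<close>.\<close>

lemma thickly_syndetic_Int: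
  assumes "thickly_syndetic A" "thickly_syndetic B"
  shows "thickly_syndetic (A \<inter> B)"
  unfolding thickly_syndetic_def
proof (intro allI impI)
  fix k :: nat assume "k \<ge> 1"
  then obtain L where L: "L \<ge> 1" "\<And>n. n \<ge> 1 \<Longrightarrow> {n..n + L} \<inter> {n. {n..n + k} \<subseteq> B} \<noteq> {}"
    using assms(2) unfolding thickly_syndetic_def syndetic_def by blast
  have "L + k \<ge> 1" using L by simp
  then obtain M where M: "M \<ge> 1" "\<And>n. n \<ge> 1 \<Longrightarrow> {n..n + M} \<inter> {n. {n..n + (L + k)} \<subseteq> A} \<noteq> {}"
    using assms(1) unfolding thickly_syndetic_def syndetic_def by blast
  have "{n..n + (M + L)} \<inter> {n. {n..n + k} \<subseteq> A \<inter> B} \<noteq> {}" if n: "n \<ge> 1" for n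
  proof -
    obtain m where m: "m \<in> {n..n + M}" "{m..m + (L + k)} \<subseteq> A" using M(2)[OF n] by blast
    then have "m \<ge> 1" using n by simp
    then obtain l where l: "l \<in> {m..m + L}" "{l..l + k} \<subseteq> B" using L(2) by blast
    have "{l..l + k} \<subseteq> {m..m + (L + k)}" using l(1) by auto
    then have "{l..l + k} \<subseteq> A \<inter> B" using m(2) l(2) by blast
    moreover have "l \<in> {n..n + (M + L)}" using m(1) l(1) by auto
    ultimately show ?thesis by blast
  qed
  moreover have "M + L \<ge> 1" using L by simp
  ultimately show "syndetic {n. {n..n + k} \<subseteq> A \<inter> B}" unfolding syndetic_def by blast
qed

lemma thickly_syndetic_INT:
  fixes A :: "'b \<Rightarrow> nat set"
  assumes "finite I" "I \<noteq> {}" "\<And>i. i \<in> I \<Longrightarrow> thickly_syndetic (A i)"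
  shows "thickly_syndetic (\<Inter>i\<in>I. A i)"
  using assms by (induction I rule: finite_ne_induct) (auto intro: thickly_syndetic_Int)

lemma thickly_syndetic_imp_thick:
  assumes "thickly_syndetic A"
  shows "thick A"
  unfolding thick_def
proof (intro allI impI)
  fix k :: nat assume "k \<ge> 1"
  then obtain L where "\<And>n. n \<ge> 1 \<Longrightarrow> {n..n + L} \<inter> {n. {n..n + k} \<subseteq> A} \<noteq> {}"
    using assms unfolding thickly_syndetic_def syndetic_def by blast
  then have "{1..1 + L} \<inter> {n. {n..n + k} \<subseteq> A} \<noteq> {}" by blast
  then show "\<exists>n\<ge>1. {n..n + k} \<subseteq> A" by auto
qed

lemma thickly_syndetically_imp_thickly_sensitive:
  "thickly_syndetically_sensitive T \<mu> r \<Longrightarrow> thickly_sensitive T \<mu> r"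
  unfolding thickly_syndetically_sensitive_def thickly_sensitive_def
  using thickly_syndetic_imp_thick by blast

text \<open>Thickly syndetic sets are closed under finite intersections and nonempty.\<close>

lemma thickly_syndetically_imp_multi_sensitive:
  assumes "thickly_syndetically_sensitive T \<mu> r"
  shows "multi_sensitive T \<mu> r"
proof -
  obtain \<delta> where \<delta>: "\<delta> > 0" "\<And>U. U \<in> borel_pos \<mu> \<Longrightarrow> thickly_syndetic (N_T T U \<delta> r)"
    using assms unfolding thickly_syndetically_sensitive_def by blast
  have "(\<Inter>i\<in>{1..k}. N_T T (U i) \<delta> r) \<noteq> {}"
    if "k \<ge> 1" "\<forall>i\<in>{1..k}. U i \<in> borel_pos \<mu>" for k :: nat and U
  proof -
    have "thickly_syndetic (\<Inter>i\<in>{1..k}. N_T T (U i) \<delta> r)"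
      using that \<delta>(2) by (intro thickly_syndetic_INT) auto
    then have "thick (\<Inter>i\<in>{1..k}. N_T T (U i) \<delta> r)" by (rule thickly_syndetic_imp_thick)
    then obtain n where "{n..n + 1} \<subseteq> (\<Inter>i\<in>{1..k}. N_T T (U i) \<delta> r)"
      unfolding thick_def by blast
    then show ?thesis by force
  qed
  then show ?thesis unfolding multi_sensitive_def using \<delta>(1) by blast
qed

theorem theorem1p2:
  fixes T :: "'a::metric_space \<Rightarrow> 'a" and \<mu> :: "'a measure" and r :: nat
  assumes "minimal_tds T"
    and "invariant_prob T \<mu>"
    and "r \<ge> 2"
  shows "(multi_sensitive T \<mu> r \<longleftrightarrow> thickly_sensitive T \<mu> r) \<and>
    (thickly_sensitive T \<mu> r \<longleftrightarrow> thickly_syndetically_sensitive T \<mu> r) \<and>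
    (thickly_syndetically_sensitive T \<mu> r \<longleftrightarrow>
      (\<forall>m\<in>{1..r - 1}. \<not> almost_to_one m (X_eq T) (pi_eq T)))"
proof -
  have "prob_space \<mu>" using assms(2) by (simp add: invariant_prob_def)
  then interpret minimal_measure_system T \<mu>
    using assms(1,2)
    by (intro minimal_measure_system.intro minimal_system.intro minimal_measure_system_axioms.intro)
  have "thickly_syndetically_sensitive T \<mu> r"
    if large: "\<forall>x. infinite (pi_eq T x) \<or> r \<le> card (pi_eq T x)"
  proof -
    obtain d where d: "d > 0" "\<And>x. x \<in> separated r d"
      using uniformly_separated[of r, OF large[rule_format]] by metis
    have "d / 2 > 0" using d(1) by simp
    then show ?thesis
      unfolding thickly_syndetically_sensitive_def using thickly_syndetic_N_T[OF d] by blast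
  qed
  \<comment> \<open>Large fibres imply thickly syndetic sensitivity, which implies the other two
    notions; multi-sensitivity implies thick sensitivity, which forces large fibres.\<close>
  then show ?thesis
    unfolding not_almost_to_one_iff
    using multi_sensitive_imp_thickly_sensitive[of r] thickly_sensitive_imp_large_fibers[of r]
      thickly_syndetically_imp_thickly_sensitive[of T \<mu> r]
      thickly_syndetically_imp_multi_sensitive[of T \<mu> r]
    by blast
qed

end
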